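(* Let $\{X_t\}_{t\in\mathbb{N}}$ be the Markov chain on $(0,1)$ in which, given $X_{t-1}=x\in(0,1)$, the next state $X_t$ is, with probability $\tfrac12$ each, uniformly distributed on $(0,x)$ or uniformly distributed on $(x,1)$. Then the (unique) stationary distribution of $\{X_t\}_{t\in\mathbb{N}}$ is the arcsine distribution, i.e. the probability distribution on $(0,1)$ with density $$\rho(s)=\frac{1}{\pi}\,\frac{1}{\sqrt{s(1-s)}}\,\mathbf 1_{s\in(0,1)}.$$
   Context: Equivalently, the chain has transition kernel $K_X(s,x)=\frac1{2x}\mathbf 1_{0<s<x}+\frac1{2(1-x)}\mathbf 1_{x<s<1}$, where $x$ is the current state and $s\mapsto K_X(s,x)$ is the density of the next state. A probability distribution $\mu$ on $(0,1)$ is stationary if $X_{t-1}\sim\mu$ implies $X_t\sim\mu$; for a density $\rho$ this means $\rho(s)=\int_0^1K_X(s,x)\rho(x)\,dx$ for almost every $s$. *)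

theory Defs
  imports "HOL-Probability.Probability"
begin

definition unit_lborel :: "real measure" where
  "unit_lborel = restrict_space lborel {0<..<1}"

text \<open>Only the values at \<open>x \<in> {0<..<1}\<close> matter; elsewhere the definition carries no meaning.\<close>

definition split_step :: "real \<Rightarrow> real measure" where
  "split_step x =
     measure_pmf (bernoulli_pmf (1/2)) \<bind>
       (\<lambda>left. if left then uniform_measure unit_lborel {0<..<x}
                       else uniform_measure unit_lborel {x<..<1})"

text \<open>
  If \<open>X\<close> has law \<open>\<mu>\<close> and the conditional law of the next state given \<open>X = x\<close> is \<open>K x\<close>, then
  the next state has law \<open>\<mu> \<bind> K\<close>. The Giry bind is only meaningful for a measurable \<open>K\<close>; for
  \<open>split_step\<close> this is \<open>measurable_split_step\<close> below.
\<close>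

definition stationary_distribution ::
    "'a measure \<Rightarrow> ('a \<Rightarrow> 'a measure) \<Rightarrow> 'a measure \<Rightarrow> bool" where
  "stationary_distribution S K \<mu> \<longleftrightarrow>
     prob_space \<mu> \<and> sets \<mu> = sets S \<and> \<mu> \<bind> K = \<mu>"

definition arcsine_density :: "real \<Rightarrow> real" where
  "arcsine_density s = 1 / pi * (1 / sqrt (s * (1 - s))) * indicator {0<..<1} s"

definition arcsine_distribution :: "real measure" where
  "arcsine_distribution = density unit_lborel (\<lambda>s. ennreal (arcsine_density s))"

lemma space_unit_lborel [simp]: "space unit_lborel = {0<..<1}"
  by (simp add: unit_lborel_def space_restrict_space)

lemma sets_unit_lborel: "sets unit_lborel = sets (restrict_space borel {0<..<1::real})"
  unfolding unit_lborel_def by (intro sets_restrict_space_cong) simp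

lemma sigma_finite_unit_lborel: "sigma_finite_measure unit_lborel"
  unfolding unit_lborel_def
  by (rule sigma_finite_measure_restrict_space) (auto intro: lborel.sigma_finite_measure_axioms)

lemma interval_in_unit_lborel:
  assumes "0 \<le> a" "b \<le> 1"
  shows "{a<..<b} \<in> sets unit_lborel"
  using assms by (auto simp: unit_lborel_def sets_restrict_space_iff)

lemma emeasure_unit_lborel_interval:
  assumes "0 \<le> a" "a \<le> b" "b \<le> 1"
  shows "emeasure unit_lborel {a<..<b} = ennreal (b - a)"
  using assms unfolding unit_lborel_def
  by (subst emeasure_restrict_space) (auto simp: greaterThanLessThan_subseteq_greaterThanLessThan)

lemma prob_space_uniform_interval:
  assumes "0 \<le> a" "a < b" "b \<le> 1"
  shows "prob_space (uniform_measure unit_lborel {a<..<b})"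
  using assms by (intro prob_space_uniform_measure) (auto simp: emeasure_unit_lborel_interval)

definition split_step_density :: "real \<Rightarrow> real \<Rightarrow> real" where
  "split_step_density s x =
     1 / (2 * x) * indicator {0<..<x} s + 1 / (2 * (1 - x)) * indicator {x<..<1} s"

lemma split_step_kernel_into:
  assumes "x \<in> {0<..<1}"
  shows "(\<lambda>left. if left then uniform_measure unit_lborel {0<..<x}
                         else uniform_measure unit_lborel {x<..<1})
           \<in> measurable (measure_pmf (bernoulli_pmf (1/2))) (subprob_algebra unit_lborel)"
  using assms
  by (auto simp: space_subprob_algebra split: if_splits
           intro!: prob_space_imp_subprob_space prob_space_uniform_interval)

lemma sets_split_step:
  assumes "x \<in> {0<..<1}"
  shows "sets (split_step x) = sets unit_lborel"
  unfolding split_step_def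
  by (rule sets_bind[where N = unit_lborel]) auto

lemma split_step_eq_density:
  assumes x: "x \<in> {0<..<1}"
  shows "split_step x = density unit_lborel (\<lambda>s. ennreal (split_step_density s x))"
proof (rule measure_eqI)
  show "sets (split_step x) = sets (density unit_lborel (\<lambda>s. ennreal (split_step_density s x)))"
    using sets_split_step[OF x] by simp
next
  fix A assume "A \<in> sets (split_step x)"
  then have A[measurable]: "A \<in> sets unit_lborel" using sets_split_step[OF x] by simp
  have I[measurable]: "{0<..<x} \<in> sets unit_lborel" "{x<..<1} \<in> sets unit_lborel"
    using x by (auto intro!: interval_in_unit_lborel)
  have e: "emeasure unit_lborel {0<..<x} = ennreal x" 
          "emeasure unit_lborel {x<..<1} = ennreal (1 - x)"
    using x by (auto simp: emeasure_unit_lborel_interval)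
  have "emeasure (split_step x) A =
      (emeasure unit_lborel ({0<..<x} \<inter> A) / ennreal x) * ennreal (1/2)
      + (emeasure unit_lborel ({x<..<1} \<inter> A) / ennreal (1 - x)) * ennreal (1/2)"
    unfolding split_step_def
    by (subst emeasure_bind[OF _ split_step_kernel_into[OF x] A])
       (simp_all add: nn_integral_bernoulli_pmf emeasure_uniform_measure e)
  also have "\<dots> = ennreal (1 / (2*x)) * emeasure unit_lborel ({0<..<x} \<inter> A) +
       ennreal (1 / (2*(1-x))) * emeasure unit_lborel ({x<..<1} \<inter> A)"
  proof -
    have *: "m / ennreal c * ennreal (1/2) = ennreal (1 / (2*c)) * m" if "0 < c" for m c
    proof -
      have "m / ennreal c * ennreal (1/2) = m * (ennreal (inverse c) * ennreal (1/2))"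
        using that by (simp only: divide_ennreal_def inverse_ennreal mult.assoc)
      also have "ennreal (inverse c) * ennreal (1/2) = ennreal (1 / (2*c))"
        using that by (subst ennreal_mult[symmetric]) (auto simp: field_simps)
      finally show ?thesis by (simp add: mult.commute)
    qed
    show ?thesis using x by (simp only: *[of x] *[of "1 - x"] greaterThanLessThan_iff diff_gt_0_iff_gt)
  qed
  also have "\<dots> = (\<integral>\<^sup>+s. ennreal (1 / (2*x)) * indicator ({0<..<x} \<inter> A) s
        + ennreal (1 / (2*(1-x))) * indicator ({x<..<1} \<inter> A) s \<partial>unit_lborel)"
    by (simp add: nn_integral_add nn_integral_cmult)
  also have "\<dots> = (\<integral>\<^sup>+s. ennreal (split_step_density s x) * indicator A s \<partial>unit_lborel)"
    using x by (intro nn_integral_cong) (auto simp: split_step_density_def indicator_def)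
  also have "\<dots> = emeasure (density unit_lborel (\<lambda>s. ennreal (split_step_density s x))) A"
    by (subst emeasure_density) (auto simp: split_step_density_def)
  finally show "emeasure (split_step x) A =
     emeasure (density unit_lborel (\<lambda>s. ennreal (split_step_density s x))) A" .
qed

lemma prob_space_split_step:
  assumes x: "x \<in> {0<..<1}"
  shows "prob_space (split_step x)"
  unfolding split_step_def
  by (rule prob_space.prob_space_bind[OF _ _ split_step_kernel_into[OF x]])
     (use x in \<open>auto simp: prob_space_measure_pmf intro!: prob_space_uniform_interval\<close>)

lemma measurable_split_step:
  "split_step \<in> measurable unit_lborel (prob_algebra unit_lborel)"
proof -
  interpret sigma_finite_measure unit_lborel by (rule sigma_finite_unit_lborel)
  have b: "(\<lambda>x. x) \<in> borel_measurable unit_lborel"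
    unfolding measurable_cong_sets[OF sets_unit_lborel refl] by (simp add: measurable_restrict_space1)
  have [measurable]: "(\<lambda>p. fst p) \<in> borel_measurable (unit_lborel \<Otimes>\<^sub>M unit_lborel)"
       "(\<lambda>p. snd p) \<in> borel_measurable (unit_lborel \<Otimes>\<^sub>M unit_lborel)"
    using measurable_compose[OF measurable_fst b] measurable_compose[OF measurable_snd b] by auto
  have d: "(\<lambda>p. ennreal (split_step_density (snd p) (fst p)))
       \<in> borel_measurable (unit_lborel \<Otimes>\<^sub>M unit_lborel)"
    unfolding split_step_density_def indicator_def greaterThanLessThan_iff of_bool_def by measurable
  show ?thesis
  proof (rule measurable_prob_algebraI)
    show "prob_space (split_step x)" if "x \<in> space unit_lborel" for x
      using prob_space_split_step that by simp
    show "split_step \<in> measurable unit_lborel (subprob_algebra unit_lborel)"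
    proof (rule measurable_subprob_algebra)
      fix x assume "x \<in> space unit_lborel"
      then show "subprob_space (split_step x)" "sets (split_step x) = sets unit_lborel"
        using prob_space_split_step sets_split_step by (auto intro: prob_space_imp_subprob_space)
    next
      fix A assume A[measurable]: "A \<in> sets unit_lborel"
      have "(\<lambda>x. \<integral>\<^sup>+s. ennreal (split_step_density s x) * indicator A s \<partial>unit_lborel)
          \<in> borel_measurable unit_lborel"
        using d by measurable
      moreover have "emeasure (split_step x) A =
          (\<integral>\<^sup>+s. ennreal (split_step_density s x) * indicator A s \<partial>unit_lborel)"
        if "x \<in> space unit_lborel" for x
        using that A measurable_compose[OF measurable_Pair1'[OF that] d]
        by (subst split_step_eq_density) (auto simp: emeasure_density)
      ultimately show "(\<lambda>x. emeasure (split_step x) A) \<in> borel_measurable unit_lborel"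
        by (subst measurable_cong) auto
    qed
  qed
qed

end

theory Submission
  imports Defs
begin

text \<open>
  A stationary law \<open>\<mu>\<close> equals \<open>\<mu> \<bind> split_step\<close>, so it has a density, and this density is invariant
  under the integral operator \<open>T\<close> of the kernel. If \<open>f\<close> and \<open>g\<close> are two invariant probability
  densities and \<open>m = min f g\<close>, then \<open>T m \<le> m\<close>, and \<open>T\<close> preserves total mass, so \<open>T m = m\<close>. Hence
  \<open>f - m\<close> is invariant as well; as the kernel is positive almost everywhere, \<open>f - m\<close> is either
  zero almost everywhere or positive almost everywhere. So \<open>f \<le> g\<close> or \<open>g \<le> f\<close> almost everywhere,
  and equality of the total masses gives \<open>f = g\<close>.

  Invariance of the arcsine density is a computation with the antiderivatives
  \<open>- sqrt ((1 - x) / x)\<close> and \<open>sqrt (x / (1 - x))\<close> of \<open>1 / (2 * x * sqrt (x * (1 - x)))\<close> and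
  \<open>1 / (2 * (1 - x) * sqrt (x * (1 - x)))\<close>.
\<close>

section \<open>Uniqueness of invariant probability densities\<close>

text \<open>If \<open>f x < g x\<close> held on a set of positive measure, the integral of
  \<open>f\<close>, being finite, would be strictly smaller than that of \<open>g\<close>.\<close>

lemma AE_eq_of_nn_integral_eq:
  assumes [measurable]: "f \<in> borel_measurable M" "g \<in> borel_measurable M"
    and le: "AE x in M. f x \<le> g x"
    and eq: "(\<integral>\<^sup>+x. f x \<partial>M) = (\<integral>\<^sup>+x. g x \<partial>M)"
    and fin: "(\<integral>\<^sup>+x. f x \<partial>M) \<noteq> \<infinity>"
  shows "AE x in M. f x = g x"
proof -
  have "AE x in M. g x \<le> f x"
    using nn_integral_less[OF assms(1,2) fin le] eq by auto
  with le show ?thesis by eventually_elim auto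
qed

lemma (in sigma_finite_measure) invariant_density_unique:
  fixes k :: "'a \<Rightarrow> 'a \<Rightarrow> ennreal"
  assumes k[measurable]: "(\<lambda>(s, x). k s x) \<in> borel_measurable (M \<Otimes>\<^sub>M M)"
    and pos: "\<And>s. s \<in> space M \<Longrightarrow> AE x in M. 0 < k s x"
    and markov: "\<And>x. x \<in> space M \<Longrightarrow> (\<integral>\<^sup>+s. k s x \<partial>M) = 1"
    and f[measurable]: "f \<in> borel_measurable M" and f1: "(\<integral>\<^sup>+x. f x \<partial>M) = 1"
    and g[measurable]: "g \<in> borel_measurable M" and g1: "(\<integral>\<^sup>+x. g x \<partial>M) = 1"
    and f_inv: "AE s in M. (\<integral>\<^sup>+x. k s x * f x \<partial>M) = f s"
    and g_inv: "AE s in M. (\<integral>\<^sup>+x. k s x * g x \<partial>M) = g s"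
  shows "AE s in M. f s = g s"
proof -
  interpret P: pair_sigma_finite M M ..
  define T where "T h s = (\<integral>\<^sup>+x. k s x * h x \<partial>M)" for h s
  define m where "m x = min (f x) (g x)" for x
  \<comment> \<open>Where \<open>f\<close> is finite, \<open>p\<close> is the positive part of
    \<open>f - g\<close>. Where \<open>f\<close> is infinite, so is \<open>p\<close>, since
    \<open>\<infinity> - c = \<infinity>\<close> in \<open>ennreal\<close>.\<close>
  define p where "p x = f x - m x" for x
  have [measurable]: "m \<in> borel_measurable M" "p \<in> borel_measurable M"
    unfolding m_def p_def by measurable
  have [measurable]: "T h \<in> borel_measurable M" if [measurable]: "h \<in> borel_measurable M" for h
    unfolding T_def by measurable
  have T_mono: "T h s \<le> T h' s" if "\<And>x. h x \<le> h' x" for h h' s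
    unfolding T_def using that by (intro nn_integral_mono mult_left_mono) auto
  have m_le: "m x \<le> f x" "m x \<le> g x" for x by (auto simp: m_def)
  \<comment> \<open>Total mass is preserved: after exchanging the integrals, the kernel is
    integrated over the target \<open>s\<close> first and contributes 1 by
    \<open>markov\<close>.\<close>
  have int_T: "(\<integral>\<^sup>+s. T m s \<partial>M) = (\<integral>\<^sup>+x. m x \<partial>M)"
  proof -
    have "(\<integral>\<^sup>+s. T m s \<partial>M) = (\<integral>\<^sup>+x. (\<integral>\<^sup>+s. k s x * m x \<partial>M) \<partial>M)"
      unfolding T_def by (rule P.Fubini'[symmetric]) measurable
    also have "\<dots> = (\<integral>\<^sup>+x. m x \<partial>M)"
      by (intro nn_integral_cong) (simp add: nn_integral_multc markov)
    finally show ?thesis .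
  qed
  \<comment> \<open>Since \<open>m\<close> lies below both densities, monotonicity gives
    \<open>T m \<le> T f = f\<close> and \<open>T m \<le> T g = g\<close> almost everywhere.\<close>
  have Tm_le: "AE s in M. T m s \<le> m s"
    using f_inv g_inv
  proof eventually_elim
    case (elim s)
    show ?case
      using T_mono[of m f s] T_mono[of m g s] m_le elim by (auto simp: T_def m_def)
  qed
  have m_fin: "(\<integral>\<^sup>+x. m x \<partial>M) \<noteq> \<infinity>"
    using nn_integral_mono[of M m f] m_le f1 by (auto simp: top_unique)
  have Tm: "AE s in M. T m s = m s"
    by (rule AE_eq_of_nn_integral_eq[OF _ _ Tm_le]) (use int_T m_fin in auto)
  have f_split: "f x = m x + p x" for x
    unfolding p_def using m_le by (simp add: add_diff_inverse_ennreal)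
  \<comment> \<open>In \<open>ennreal\<close>, cancelling \<open>m s\<close> from
    \<open>m s + T p s = m s + p s\<close> requires \<open>m s\<close> to be finite.\<close>
  have "AE s in M. m s \<noteq> \<infinity>"
    by (rule nn_integral_noteq_infinite[OF _ m_fin]) measurable
  with Tm f_inv AE_space have Tp: "AE s in M. T p s = p s"
  proof eventually_elim
    case (elim s)
    have [measurable]: "(\<lambda>x. k s x) \<in> borel_measurable M"
      using \<open>s \<in> space M\<close> by measurable
    have "m s + T p s = T m s + T p s" using elim by simp
    also have "\<dots> = T f s"
      unfolding T_def f_split by (subst nn_integral_add[symmetric]) (auto simp: distrib_left)
    also have "\<dots> = m s + p s" using elim f_split[of s] by (simp add: T_def)
    finally show ?case using elim by (simp add: ennreal_add_left_cancel)
  qed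
  show ?thesis
  proof (cases "AE x in M. p x = 0")
    case True
    then have "AE x in M. f x \<le> g x"
      by eventually_elim (metis f_split add.right_neutral m_le(2))
    then show ?thesis
      by (rule AE_eq_of_nn_integral_eq[rotated 2]) (use f1 g1 in auto)
  next
    case False
    \<comment> \<open>By positivity of the kernel, \<open>T p s = 0\<close> at a single point
      \<open>s\<close> would already force \<open>p = 0\<close> almost everywhere.\<close>
    have Tp_pos: "T p s \<noteq> 0" if s: "s \<in> space M" for s
    proof
      have [measurable]: "(\<lambda>x. k s x) \<in> borel_measurable M"
        using s by measurable
      assume "T p s = 0"
      then have "AE x in M. k s x * p x = 0"
        unfolding T_def by (subst (asm) nn_integral_0_iff_AE) auto
      with pos[OF s] have "AE x in M. p x = 0"
        by eventually_elim auto
      with False show False by simp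
    qed
    from Tp AE_space have "AE x in M. g x \<le> f x"
    proof eventually_elim
      case (elim x)
      then have "p x \<noteq> 0" using Tp_pos[of x] by auto
      \<comment> \<open>Where \<open>f x\<close> is infinite, \<open>p x \<noteq> 0\<close> says
        nothing about \<open>m x\<close>, but \<open>g x \<le> f x\<close> is then trivial.\<close>
      then have "m x \<noteq> f x" if "f x \<noteq> \<infinity>" using that by (auto simp: p_def)
      then show ?case by (cases "f x = \<infinity>") (auto simp: m_def min_def split: if_splits)
    qed
    then have "AE x in M. g x = f x"
      by (rule AE_eq_of_nn_integral_eq[rotated 2]) (use f1 g1 in auto)
    then show ?thesis by eventually_elim simp
  qed
qed

section \<open>The law of the next state as a density\<close>

lemma emeasure_density_space:
  "f \<in> borel_measurable M \<Longrightarrow> emeasure (density M f) (space M) = (\<integral>\<^sup>+x. f x \<partial>M)"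
  by (subst emeasure_density) (auto intro!: nn_integral_cong)

lemma measurable_unit_lborel_ident [measurable]:
  "(\<lambda>x. x) \<in> borel_measurable unit_lborel"
  unfolding measurable_cong_sets[OF sets_unit_lborel refl] by (simp add: measurable_restrict_space1)

lemma measurable_split_step_density [measurable]:
  "(\<lambda>(s, x). ennreal (split_step_density s x)) \<in> borel_measurable (unit_lborel \<Otimes>\<^sub>M unit_lborel)"
proof -
  have [measurable]: "(\<lambda>p. fst p) \<in> borel_measurable (unit_lborel \<Otimes>\<^sub>M unit_lborel)"
       "(\<lambda>p. snd p) \<in> borel_measurable (unit_lborel \<Otimes>\<^sub>M unit_lborel)"
    using measurable_compose[OF measurable_fst measurable_unit_lborel_ident]
      measurable_compose[OF measurable_snd measurable_unit_lborel_ident] by auto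
  \<comment> \<open>The intervals inside the indicators depend on \<open>x\<close>, so the
    indicators are rewritten as comparisons between the two coordinates.\<close>
  show ?thesis
    unfolding split_step_density_def indicator_def greaterThanLessThan_iff of_bool_def case_prod_beta'
    by measurable
qed

text \<open>By Fubini, averaging the densities of \<open>split_step x\<close> over the starting
  point gives a density of the next state. As \<open>\<mu>\<close> itself need not have a density,
  this is how a stationary law acquires one.\<close>

lemma bind_split_step:
  assumes "prob_space \<mu>" and sets: "sets \<mu> = sets unit_lborel"
  shows "\<mu> \<bind> split_step
       = density unit_lborel (\<lambda>s. \<integral>\<^sup>+x. ennreal (split_step_density s x) \<partial>\<mu>)"
proof -
  interpret prob_space \<mu> by fact
  interpret U: sigma_finite_measure unit_lborel by (rule sigma_finite_unit_lborel)
  interpret P: pair_sigma_finite unit_lborel \<mu> ..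
  have space: "space \<mu> = {0<..<1}" using sets_eq_imp_space_eq[OF sets] by simp
  have k: "(\<lambda>(s, x). ennreal (split_step_density s x)) \<in> borel_measurable (unit_lborel \<Otimes>\<^sub>M \<mu>)"
    by (subst measurable_cong_sets[OF sets_pair_measure_cong[OF refl sets] refl]) measurable
  note [measurable] = k
  have K: "split_step \<in> measurable \<mu> (subprob_algebra unit_lborel)"
    using measurable_prob_algebraD[OF measurable_split_step]
    by (simp add: measurable_cong_sets[OF sets refl])
  show ?thesis
  proof (rule measure_eqI)
    show *: "sets (\<mu> \<bind> split_step)
        = sets (density unit_lborel (\<lambda>s. \<integral>\<^sup>+x. ennreal (split_step_density s x) \<partial>\<mu>))"
      using space by (subst sets_bind[where N = unit_lborel]) (auto simp: sets_split_step)
    fix A assume "A \<in> sets (\<mu> \<bind> split_step)"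
    then have A[measurable]: "A \<in> sets unit_lborel" using * by simp
    have "emeasure (\<mu> \<bind> split_step) A = (\<integral>\<^sup>+x. emeasure (split_step x) A \<partial>\<mu>)"
      using space by (subst emeasure_bind[OF _ K A]) auto
    also have "\<dots> = (\<integral>\<^sup>+x. (\<integral>\<^sup>+s. ennreal (split_step_density s x) * indicator A s \<partial>unit_lborel) \<partial>\<mu>)"
    proof (rule nn_integral_cong)
      fix x assume x: "x \<in> space \<mu>"
      then have [measurable]: "(\<lambda>s. ennreal (split_step_density s x)) \<in> borel_measurable unit_lborel"
        by measurable
      show "emeasure (split_step x) A
          = (\<integral>\<^sup>+s. ennreal (split_step_density s x) * indicator A s \<partial>unit_lborel)"
        using x space by (subst split_step_eq_density) (auto simp: emeasure_density)
    qed
    also have "\<dots> = (\<integral>\<^sup>+s. (\<integral>\<^sup>+x. ennreal (split_step_density s x) * indicator A s \<partial>\<mu>) \<partial>unit_lborel)"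
      by (rule P.Fubini') measurable
    also have "\<dots> = (\<integral>\<^sup>+s. (\<integral>\<^sup>+x. ennreal (split_step_density s x) \<partial>\<mu>) * indicator A s \<partial>unit_lborel)"
      by (intro nn_integral_cong nn_integral_multc) measurable
    also have "\<dots> = emeasure (density unit_lborel
        (\<lambda>s. \<integral>\<^sup>+x. ennreal (split_step_density s x) \<partial>\<mu>)) A"
      by (subst emeasure_density) auto
    finally show "emeasure (\<mu> \<bind> split_step) A = \<dots>" .
  qed
qed

section \<open>Integrals of the arcsine density\<close>

text \<open>The integrands below blow up at one or both ends of the interval, so the antiderivative
  enters there through its one-sided limits. Nonnegativity makes the improper integral a Lebesgue
  integral.\<close>

lemma nn_integral_FTC_greaterThanLessThan:
  fixes f F :: "real \<Rightarrow> real"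
  assumes "a < b"
    and F: "\<And>x. a < x \<Longrightarrow> x < b \<Longrightarrow> DERIV F x :> f x"
    and f: "continuous_on {a<..<b} f"
    and nonneg: "\<And>x. a < x \<Longrightarrow> x < b \<Longrightarrow> 0 \<le> f x"
    and A: "(F \<longlongrightarrow> A) (at_right a)" and B: "(F \<longlongrightarrow> B) (at_left b)"
  shows "(\<integral>\<^sup>+x. ennreal (f x) * indicator {a<..<b} x \<partial>lborel) = ennreal (B - A)"
proof -
  have cont: "isCont f x" if "a < x" "x < b" for x
    using f that by (auto simp: continuous_on_eq_continuous_at)
  have lims: "((F \<circ> real_of_ereal) \<longlongrightarrow> A) (at_right (ereal a))"
       "((F \<circ> real_of_ereal) \<longlongrightarrow> B) (at_left (ereal b))"
    using A B by (auto simp: ereal_tendsto_simps1)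
  have int: "set_integrable lborel (einterval a b) f" and val: "(LBINT x=a..b. f x) = B - A"
    using interval_integral_FTC_nonneg[of "ereal a" "ereal b" F f A B] assms cont lims by auto
  have "(\<integral>\<^sup>+x. ennreal (f x) * indicator {a<..<b} x \<partial>lborel)
      = (\<integral>\<^sup>+x. ennreal (indicator {a<..<b} x *\<^sub>R f x) \<partial>lborel)"
    by (intro nn_integral_cong) (auto simp: indicator_def)
  also have "\<dots> = ennreal (LBINT x. indicator {a<..<b} x *\<^sub>R f x)"
    using int nonneg by (intro nn_integral_eq_integral) (auto simp: set_integrable_def indicator_def)
  also have "(LBINT x. indicator {a<..<b} x *\<^sub>R f x) = B - A"
    using val \<open>a < b\<close> by (simp add: interval_lebesgue_integral_def set_lebesgue_integral_def)
  finally show ?thesis .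
qed

lemma nn_integral_unit_lborel:
  "(\<integral>\<^sup>+x. f x \<partial>unit_lborel) = (\<integral>\<^sup>+x. f x * indicator {0<..<1} x \<partial>lborel)"
  unfolding unit_lborel_def by (subst nn_integral_restrict_space) auto

lemma nn_integral_arcsine_density: "(\<integral>\<^sup>+x. ennreal (arcsine_density x) \<partial>unit_lborel) = 1"
proof -
  \<comment> \<open>The affine map \<open>2 * x - 1\<close> carries (0,1) to (-1,1) and turns
    \<open>4 * x * (1 - x)\<close> into one minus a square, hence the arcsine. \<open>F\<close>
    rises from -1/2 to 1/2.\<close>
  define F where "F x = arcsin (2 * x - 1) / pi" for x :: real
  have "(\<integral>\<^sup>+x. ennreal (arcsine_density x) \<partial>unit_lborel)
      = (\<integral>\<^sup>+x. ennreal (1 / pi * (1 / sqrt (x * (1 - x)))) * indicator {0<..<1} x \<partial>lborel)"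
    unfolding nn_integral_unit_lborel
    by (intro nn_integral_cong) (auto simp: arcsine_density_def indicator_def)
  also have "\<dots> = ennreal (F 1 - F 0)"
  proof (rule nn_integral_FTC_greaterThanLessThan)
    fix x :: real assume x: "0 < x" "x < 1"
    have "sqrt (1 - (2 * x - 1)\<^sup>2) = sqrt (2\<^sup>2 * (x * (1 - x)))"
      by (rule arg_cong[where f = sqrt]) (simp add: power2_eq_square algebra_simps)
    also have "\<dots> = 2 * sqrt (x * (1 - x))"
      by (simp only: real_sqrt_mult real_sqrt_abs)
    finally have *: "sqrt (1 - (2 * x - 1)\<^sup>2) = 2 * sqrt (x * (1 - x))" .
    show "DERIV F x :> 1 / pi * (1 / sqrt (x * (1 - x)))"
      unfolding F_def using x
      by (auto intro!: derivative_eq_intros simp: * inverse_eq_divide)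
  next
    \<comment> \<open>\<open>F\<close> is not differentiable at 0 and 1, but it is continuous there,
      which supplies the limits.\<close>
    have "continuous_on {0..1} F"
      unfolding F_def by (intro continuous_intros) auto
    then show "(F \<longlongrightarrow> F 0) (at_right 0)" "(F \<longlongrightarrow> F 1) (at_left 1)"
      by (auto simp: continuous_on_Icc_at_rightD continuous_on_Icc_at_leftD)
  qed (auto intro!: continuous_intros)
  also have "F 1 - F 0 = 1" by (simp add: F_def field_simps)
  finally show ?thesis by simp
qed

text \<open>This is the contribution to the new density at \<open>s\<close> of the states above
  \<open>s\<close>, which reach \<open>s\<close> by a step to the left. The antiderivative vanishes
  at 1, so the lower end alone contributes.\<close>

lemma nn_integral_arcsine_above:
  assumes s: "0 < s" "s < 1"
  shows "(\<integral>\<^sup>+x. ennreal (1 / (2 * x) * (1 / pi * (1 / sqrt (x * (1 - x))))) * indicator {s<..<1} x \<partial>lborel)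
       = ennreal (1 / pi * sqrt ((1 - s) / s))"
proof -
  define F where "F x = - (sqrt ((1 - x) / x) / pi)" for x :: real
  have "(\<integral>\<^sup>+x. ennreal (1 / (2 * x) * (1 / pi * (1 / sqrt (x * (1 - x))))) * indicator {s<..<1} x \<partial>lborel)
      = ennreal (F 1 - F s)"
  proof (rule nn_integral_FTC_greaterThanLessThan)
    fix x :: real assume x: "s < x" "x < 1"
    with s have "0 < x" by simp
    \<comment> \<open>The chain rule yields \<open>1 / (2 * x^2 * sqrt ((1 - x) / x))\<close>, up to
      the factor \<open>1 / pi\<close>; this identity turns it into the integrand.\<close>
    have "sqrt ((1 - x) / x) = sqrt (x * (1 - x)) / x"
      using \<open>0 < x\<close> x by (simp add: real_sqrt_divide real_sqrt_mult divide_simps)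
    then show "DERIV F x :> 1 / (2 * x) * (1 / pi * (1 / sqrt (x * (1 - x))))"
      unfolding F_def using x \<open>0 < x\<close>
      by (auto intro!: derivative_eq_intros simp: divide_simps)
  next
    have "continuous_on {s..1} F"
      unfolding F_def using s by (intro continuous_intros) auto
    then show "(F \<longlongrightarrow> F s) (at_right s)" "(F \<longlongrightarrow> F 1) (at_left 1)"
      using s by (auto simp: continuous_on_Icc_at_rightD continuous_on_Icc_at_leftD)
  qed (use s in \<open>auto intro!: continuous_intros\<close>)
  then show ?thesis by (simp add: F_def)
qed

text \<open>Mirror image of \<open>nn_integral_arcsine_above\<close> under the reflection of (0,1)
  about 1/2: the states below \<open>s\<close> reach it by a step to the right.\<close>

lemma nn_integral_arcsine_below:
  assumes s: "0 < s" "s < 1"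
  shows "(\<integral>\<^sup>+x. ennreal (1 / (2 * (1 - x)) * (1 / pi * (1 / sqrt (x * (1 - x))))) * indicator {0<..<s} x \<partial>lborel)
       = ennreal (1 / pi * sqrt (s / (1 - s)))"
proof -
  define F where "F x = sqrt (x / (1 - x)) / pi" for x :: real
  have "(\<integral>\<^sup>+x. ennreal (1 / (2 * (1 - x)) * (1 / pi * (1 / sqrt (x * (1 - x))))) * indicator {0<..<s} x \<partial>lborel)
      = ennreal (F s - F 0)"
  proof (rule nn_integral_FTC_greaterThanLessThan)
    fix x :: real assume x: "0 < x" "x < s"
    with s have "x < 1" by simp
    have "sqrt (x * (1 - x)) = (1 - x) * sqrt (x / (1 - x))"
      using \<open>x < 1\<close> x by (simp add: real_sqrt_divide real_sqrt_mult divide_simps)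
    then show "DERIV F x :> 1 / (2 * (1 - x)) * (1 / pi * (1 / sqrt (x * (1 - x))))"
      unfolding F_def using x \<open>x < 1\<close>
      by (auto intro!: derivative_eq_intros simp: divide_simps)
  next
    have "continuous_on {0..s} F"
      unfolding F_def using s by (intro continuous_intros) auto
    then show "(F \<longlongrightarrow> F 0) (at_right 0)" "(F \<longlongrightarrow> F s) (at_left s)"
      using s by (auto simp: continuous_on_Icc_at_rightD continuous_on_Icc_at_leftD)
  qed (use s in \<open>auto intro!: continuous_intros\<close>)
  then show ?thesis by (simp add: F_def)
qed

lemma arcsine_density_invariant:
  assumes s: "s \<in> {0<..<1}"
  shows "(\<integral>\<^sup>+x. ennreal (split_step_density s x) * ennreal (arcsine_density x) \<partial>unit_lborel)
       = ennreal (arcsine_density s)"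
proof -
  \<comment> \<open>For fixed \<open>s\<close>, the condition \<open>s < x\<close> becomes the range
    \<open>{s<..<1}\<close> of \<open>x\<close>, and \<open>x < s\<close> becomes
    \<open>{0<..<s}\<close>.\<close>
  have "(\<integral>\<^sup>+x. ennreal (split_step_density s x) * ennreal (arcsine_density x) \<partial>unit_lborel)
      = (\<integral>\<^sup>+x. ennreal (1 / (2 * x) * (1 / pi * (1 / sqrt (x * (1 - x))))) * indicator {s<..<1} x
           + ennreal (1 / (2 * (1 - x)) * (1 / pi * (1 / sqrt (x * (1 - x))))) * indicator {0<..<s} x
         \<partial>lborel)"
    unfolding nn_integral_unit_lborel using s
    by (intro nn_integral_cong)
       (auto simp: split_step_density_def arcsine_density_def indicator_def ennreal_mult'[symmetric])
  also have "\<dots> = ennreal (1 / pi * sqrt ((1 - s) / s)) + ennreal (1 / pi * sqrt (s / (1 - s)))"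
    using nn_integral_arcsine_above[of s] nn_integral_arcsine_below[of s] s
    by (subst nn_integral_add) auto
  also have "\<dots> = ennreal (1 / pi * sqrt ((1 - s) / s) + 1 / pi * sqrt (s / (1 - s)))"
    using s by (intro ennreal_plus[symmetric]) auto
  also have "1 / pi * sqrt ((1 - s) / s) + 1 / pi * sqrt (s / (1 - s)) = arcsine_density s"
  proof -
    \<comment> \<open>Over the common denominator \<open>sqrt (s * (1 - s))\<close> the numerators
      are \<open>1 - s\<close> and \<open>s\<close>, with sum 1.\<close>
    have "sqrt ((1 - s) / s) + sqrt (s / (1 - s)) = 1 / sqrt (s * (1 - s))"
      using s by (simp add: real_sqrt_divide real_sqrt_mult divide_simps)
    then show ?thesis using s by (simp only: arcsine_density_def flip: distrib_left) simp
  qed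
  finally show ?thesis .
qed

lemma measurable_arcsine_density [measurable]:
  "(\<lambda>s. ennreal (arcsine_density s)) \<in> borel_measurable unit_lborel"
  unfolding arcsine_density_def indicator_def greaterThanLessThan_iff of_bool_def by measurable

section \<open>Stationarity and uniqueness of the arcsine law\<close>

lemma stationary_arcsine: "stationary_distribution unit_lborel split_step arcsine_distribution"
proof -
  have prob: "prob_space arcsine_distribution"
    by (rule prob_spaceI)
       (use emeasure_density_space[OF measurable_arcsine_density] in
         \<open>simp add: arcsine_distribution_def nn_integral_arcsine_density\<close>)
  have inv: "(\<integral>\<^sup>+x. ennreal (split_step_density s x) \<partial>arcsine_distribution)
      = ennreal (arcsine_density s)" if s: "s \<in> space unit_lborel" for s
  proof -
    from s have [measurable]: "(\<lambda>x. ennreal (split_step_density s x)) \<in> borel_measurable unit_lborel"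
      by measurable
    show ?thesis
      unfolding arcsine_distribution_def using s arcsine_density_invariant[of s]
      by (subst nn_integral_density) (auto simp: mult.commute)
  qed
  have "arcsine_distribution \<bind> split_step
      = density unit_lborel (\<lambda>s. \<integral>\<^sup>+x. ennreal (split_step_density s x) \<partial>arcsine_distribution)"
    using prob by (intro bind_split_step) (simp_all add: arcsine_distribution_def)
  also have "\<dots> = density unit_lborel (\<lambda>s. ennreal (arcsine_density s))"
    using inv measurable_arcsine_density
    by (intro density_cong AE_I2) (auto cong: measurable_cong simp del: space_unit_lborel)
  finally show ?thesis
    using prob by (simp add: stationary_distribution_def arcsine_distribution_def)
qed

lemma stationary_imp_arcsine:
  assumes "stationary_distribution unit_lborel split_step \<mu>"
  shows "\<mu> = arcsine_distribution"
proof -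
  interpret U: sigma_finite_measure unit_lborel by (rule sigma_finite_unit_lborel)
  from assms have prob: "prob_space \<mu>" and sets: "sets \<mu> = sets unit_lborel"
    and inv: "\<mu> \<bind> split_step = \<mu>"
    by (auto simp: stationary_distribution_def)
  interpret prob_space \<mu> by fact
  \<comment> \<open>By \<open>bind_split_step\<close>, \<open>f\<close> is a density of the law
    after one step, which by stationarity is \<open>\<mu>\<close> itself.\<close>
  define f where "f s = (\<integral>\<^sup>+x. ennreal (split_step_density s x) \<partial>\<mu>)" for s
  have [measurable]: "(\<lambda>(s, x). ennreal (split_step_density s x)) \<in> borel_measurable (unit_lborel \<Otimes>\<^sub>M \<mu>)"
    by (subst measurable_cong_sets[OF sets_pair_measure_cong[OF refl sets] refl]) measurable
  have f[measurable]: "f \<in> borel_measurable unit_lborel"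
    unfolding f_def by measurable
  have \<mu>: "\<mu> = density unit_lborel f"
    using bind_split_step[OF prob sets] inv by (simp add: f_def[abs_def])
  have f1: "(\<integral>\<^sup>+x. f x \<partial>unit_lborel) = 1"
    using emeasure_space_1 emeasure_density_space[OF f] unfolding \<mu> by simp
  have "AE s in unit_lborel. f s = ennreal (arcsine_density s)"
  proof (rule U.invariant_density_unique[where k = "\<lambda>s x. ennreal (split_step_density s x)"])
    fix s assume s: "s \<in> space unit_lborel"
    \<comment> \<open>For \<open>s\<close> and \<open>x\<close> in (0,1) the kernel vanishes only on
      the diagonal \<open>x = s\<close>, a null set for each \<open>s\<close>.\<close>
    have "AE x in lborel. x \<noteq> s" by (rule AE_lborel_singleton)
    then have "AE x in unit_lborel. x \<noteq> s"
      unfolding unit_lborel_def by (subst AE_restrict_space_iff) auto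
    with AE_space show "AE x in unit_lborel. 0 < ennreal (split_step_density s x)"
      by eventually_elim (use s in \<open>auto simp: split_step_density_def indicator_def\<close>)
  next
    fix x assume x: "x \<in> space unit_lborel"
    then have [measurable]: "(\<lambda>s. ennreal (split_step_density s x)) \<in> borel_measurable unit_lborel"
      by measurable
    interpret K: prob_space "split_step x" using x by (simp add: prob_space_split_step)
    show "(\<integral>\<^sup>+s. ennreal (split_step_density s x) \<partial>unit_lborel) = 1"
      using K.emeasure_space_1 x
        emeasure_density_space[of "\<lambda>s. ennreal (split_step_density s x)" unit_lborel]
      by (simp add: split_step_eq_density)
  next
    \<comment> \<open>Substituting \<open>\<mu> = density unit_lborel f\<close> into the definition
      of \<open>f\<close> gives invariance at every point of the space.\<close>
    show "AE s in unit_lborel. (\<integral>\<^sup>+x. ennreal (split_step_density s x) * f x \<partial>unit_lborel) = f s"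
    proof (rule AE_I2)
      fix s assume s: "s \<in> space unit_lborel"
      then have [measurable]: "(\<lambda>x. ennreal (split_step_density s x)) \<in> borel_measurable unit_lborel"
        by measurable
      have "f s = (\<integral>\<^sup>+x. ennreal (split_step_density s x) \<partial>density unit_lborel f)"
        using \<mu> by (simp add: f_def)
      also have "\<dots> = (\<integral>\<^sup>+x. ennreal (split_step_density s x) * f x \<partial>unit_lborel)"
        by (subst nn_integral_density) (auto simp: mult.commute)
      finally show "(\<integral>\<^sup>+x. ennreal (split_step_density s x) * f x \<partial>unit_lborel) = f s" by simp
    qed
    show "AE s in unit_lborel.
        (\<integral>\<^sup>+x. ennreal (split_step_density s x) * ennreal (arcsine_density x) \<partial>unit_lborel)
        = ennreal (arcsine_density s)"
      by (rule AE_I2) (simp add: arcsine_density_invariant)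
  qed (simp_all add: f1 nn_integral_arcsine_density)
  then show ?thesis
    unfolding \<mu> arcsine_distribution_def by (intro density_cong) auto
qed

theorem theorem2p1:
  shows "stationary_distribution unit_lborel split_step arcsine_distribution \<and>
         (\<forall>\<mu>. stationary_distribution unit_lborel split_step \<mu> \<longrightarrow> \<mu> = arcsine_distribution)"
  using stationary_arcsine stationary_imp_arcsine by blast

end
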